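(* Let $L$ be a link with $\mu$ components, and let \[U(L)=\{x\in M_A(L)\mid \phi_L(x)+1\text{ is a unit of }\Lambda_\mu\}.\] Then the operation $x\triangleright y=(\phi_L(y)+1)x-\phi_L(x)y$ defines a quandle structure on $U(L)$, with \[x\triangleright^{-1}y=(\phi_L(y)+1)^{-1}\cdot(x+\phi_L(x)y).\]
   Context: A link $L=K_1\cup\dots\cup K_\mu$ is a union of finitely many pairwise disjoint, tame (piecewise smooth), oriented embedded circles in $\mathbb{S}^3$, with indexed components. A diagram $D$ of $L$ is obtained from a regular projection to the plane (finitely many singularities, all transverse double points called crossings) by removing short segments of the underpassing arc at each crossing. $C(D)$ is the set of crossings; $A(D)$ is the set of connected components of $D$, called arcs; $\kappa:A(D)\to\{1,\dots,\mu\}$ is such that the arc $a$ is part of the image of $K_{\kappa(a)}$. At a crossing $c$, let $a_1$ be the overpassing arc, $a_2$ the underpassing arc on the right side of $a_1$ and $a_3$ the underpassing arc on the left side of $a_1$ (with respect to the orientation of $a_1$); so $\kappa(a_2)=\kappa(a_3)$. Let $\Lambda_\mu=\mathbb{Z}[t_1^{\pm1},\dots,t_\mu^{\pm1}]$. Let $\rho_D:\Lambda_\mu^{C(D)}\to\Lambda_\mu^{A(D)}$ be the $\Lambda_\mu$-linear map between free modules with $\rho_D(c)=(1-t_{\kappa(a_2)})a_1+t_{\kappa(a_1)}a_2-a_3$ at each crossing $c$. The Alexander module $M_A(L)$ is the cokernel of $\rho_D$, with quotient map $\gamma_D:\Lambda_\mu^{A(D)}\to M_A(L)$; up to isomorphism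 it does not depend on $D$. Let $I_\mu$ be the ideal of $\Lambda_\mu$ generated by $t_1-1,\dots,t_\mu-1$, and let $\phi_L:M_A(L)\to I_\mu$ be the $\Lambda_\mu$-linear epimorphism with $\phi_L(\gamma_D(a))=t_{\kappa(a)}-1$ for all $a\in A(D)$. A quandle is a set $Q$ with binary operations $\triangleright,\triangleright^{-1}:Q\times Q\to Q$ such that for all $x,y,z\in Q$: (Q1) $x\triangleright x=x$; (Q2) $(x\triangleright y)\triangleright^{-1}y=x=(x\triangleright^{-1}y)\triangleright y$; (Q3) $(x\triangleright y)\triangleright z=(x\triangleright z)\triangleright(y\triangleright z)$. *)

theory Defs
  imports
    "HOL-Analysis.Analysis"
    "HOL-Library.Poly_Mapping"
    "HOL-Algebra.Algebraic_Closure_Type"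
begin

section \<open>Quandles\<close>

definition quandle :: "'a set \<Rightarrow> ('a \<Rightarrow> 'a \<Rightarrow> 'a) \<Rightarrow> ('a \<Rightarrow> 'a \<Rightarrow> 'a) \<Rightarrow> bool" where
  "quandle Q rt rtinv \<longleftrightarrow>
     (\<forall>x\<in>Q. \<forall>y\<in>Q. rt x y \<in> Q \<and> rtinv x y \<in> Q) \<and>
     (\<forall>x\<in>Q. rt x x = x) \<and>
     (\<forall>x\<in>Q. \<forall>y\<in>Q. rtinv (rt x y) y = x \<and> rt (rtinv x y) y = x) \<and>
     (\<forall>x\<in>Q. \<forall>y\<in>Q. \<forall>z\<in>Q. rt (rt x y) z = rt (rt x z) (rt y z))"


section \<open>Free modules, quotient modules, linear maps\<close>

text \<open>
  The multiplicative fields \<open>mult\<close> and \<open>one\<close> that a module inherits from the ring record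
  play no role in the locale \<open>module\<close>; they are left unspecified below.
\<close>

definition free_module :: "('r, 'n) ring_scheme \<Rightarrow> 'b set \<Rightarrow> ('r, 'b \<Rightarrow> 'r) module" where
  "free_module R B =
     \<lparr>carrier = {f. (\<forall>b. f b \<in> carrier R) \<and>
                    finite {b. f b \<noteq> \<zero>\<^bsub>R\<^esub>} \<and> {b. f b \<noteq> \<zero>\<^bsub>R\<^esub>} \<subseteq> B},
      monoid.mult = undefined, one = undefined,
      zero = (\<lambda>b. \<zero>\<^bsub>R\<^esub>), add = (\<lambda>f g b. f b \<oplus>\<^bsub>R\<^esub> g b),
      smult = (\<lambda>r f b. r \<otimes>\<^bsub>R\<^esub> f b)\<rparr>"

definition basis_vec :: "('r, 'n) ring_scheme \<Rightarrow> 'b \<Rightarrow> 'b \<Rightarrow> 'r" where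
  "basis_vec R b = (\<lambda>b'. if b' = b then \<one>\<^bsub>R\<^esub> else \<zero>\<^bsub>R\<^esub>)"

text \<open>Scalars act on cosets by \<open>r (N + x) = N + r x\<close>; the union is over representatives.\<close>

definition quotient_module :: "('r, 'b, 'n) module_scheme \<Rightarrow> 'b set \<Rightarrow> ('r, 'b set) module" where
  "quotient_module M N =
     \<lparr>carrier = a_rcosets\<^bsub>M\<^esub> N,
      monoid.mult = undefined, one = undefined,
      zero = N, add = set_add M,
      smult = (\<lambda>r S. \<Union>x\<in>S. N +>\<^bsub>M\<^esub> (r \<odot>\<^bsub>M\<^esub> x))\<rparr>"

definition ideal_module :: "('r, 'n) ring_scheme \<Rightarrow> 'r set \<Rightarrow> ('r, 'r) module" where
  "ideal_module R I =
     \<lparr>carrier = I, monoid.mult = undefined, one = undefined,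
      zero = \<zero>\<^bsub>R\<^esub>, add = (\<lambda>x y. x \<oplus>\<^bsub>R\<^esub> y), smult = (\<lambda>r x. r \<otimes>\<^bsub>R\<^esub> x)\<rparr>"

definition linear_maps ::
  "('r, 'k) ring_scheme \<Rightarrow> ('r, 'a, 'n) module_scheme \<Rightarrow> ('r, 'b, 'l) module_scheme \<Rightarrow> ('a \<Rightarrow> 'b) set"
  where
  "linear_maps R M N =
     {f \<in> carrier M \<rightarrow> carrier N.
        (\<forall>x\<in>carrier M. \<forall>y\<in>carrier M. f (x \<oplus>\<^bsub>M\<^esub> y) = f x \<oplus>\<^bsub>N\<^esub> f y) \<and>
        (\<forall>r\<in>carrier R. \<forall>x\<in>carrier M. f (r \<odot>\<^bsub>M\<^esub> x) = r \<odot>\<^bsub>N\<^esub> f x)}"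


section \<open>Laurent polynomials\<close>

text \<open>
  Integral Laurent polynomials in variables indexed by \<open>'m\<close>: the group ring of the free
  abelian group of exponent vectors, with convolution as multiplication.
\<close>

type_synonym 'm laurent = "(int ^ 'm) \<Rightarrow>\<^sub>0 int"

abbreviation laurent_ring :: "'m::finite laurent ring" where
  "laurent_ring \<equiv> ring_of_type_algebra"

definition tvar :: "'m::finite \<Rightarrow> 'm laurent" where
  "tvar i = Poly_Mapping.single (axis i 1) 1"

definition aug_ideal :: "'m::finite laurent set" where
  "aug_ideal = genideal laurent_ring (range (\<lambda>i. tvar i \<ominus>\<^bsub>laurent_ring\<^esub> \<one>\<^bsub>laurent_ring\<^esub>))"


section \<open>Links and their diagrams\<close>

definition smooth_immersed_on :: "(real \<Rightarrow> 'a::real_normed_vector) \<Rightarrow> real set \<Rightarrow> bool" where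
  "smooth_immersed_on f S \<longleftrightarrow>
     (\<exists>F. F 0 = f \<and>
          (\<forall>n. \<forall>s\<in>S. (F n has_vector_derivative F (Suc n) s) (at s within S)) \<and>
          (\<forall>s\<in>S. F 1 s \<noteq> 0))"

text \<open>
  Smoothness is required on the closed pieces, so that one-sided derivatives of all orders
  exist at the break points; smoothness off a finite set alone would allow wild knots.
\<close>

definition piecewise_smooth_circle :: "(complex \<Rightarrow> 'a::real_normed_vector) \<Rightarrow> bool" where
  "piecewise_smooth_circle f \<longleftrightarrow>
     (\<exists>B. finite B \<and> {0, 2 * pi} \<subseteq> B \<and> B \<subseteq> {0..2 * pi} \<and>
          (\<forall>a\<in>B. \<forall>b\<in>B. a < b \<and> B \<inter> {a<..<b} = {} \<longrightarrow>
             smooth_immersed_on (\<lambda>s. f (cis s)) {a..b}))"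

text \<open>
  The components of a link in the 3-sphere are indexed by the finite type \<open>'m\<close>; each is an
  embedding of the unit circle, oriented counterclockwise.
\<close>

locale link =
  fixes K :: "'m::finite \<Rightarrow> complex \<Rightarrow> real ^ 4"
  assumes in_sphere: "K i ` sphere 0 1 \<subseteq> sphere 0 1"
    and continuous: "continuous_on (sphere 0 1) (K i)"
    and injective: "inj_on (K i) (sphere 0 1)"
    and disjoint: "i \<noteq> j \<Longrightarrow> K i ` sphere 0 1 \<inter> K j ` sphere 0 1 = {}"
    and tame: "piecewise_smooth_circle (K i)"

text \<open>
  Stereographic projection from the pole \<open>(0, 0, 0, 1)\<close> to 3-space, split into the vertical
  projection to the plane and the height.
\<close>

definition stereo_plane :: "real ^ 4 \<Rightarrow> complex" where
  "stereo_plane y = Complex (y $ 1 / (1 - y $ 4)) (y $ 2 / (1 - y $ 4))"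

definition stereo_height :: "real ^ 4 \<Rightarrow> real" where
  "stereo_height y = y $ 3 / (1 - y $ 4)"

text \<open>
  The rotation \<open>rot\<close> of the 3-sphere selects the pole and the direction of projection.
\<close>

locale link_projection = link K
  for K :: "'m::finite \<Rightarrow> complex \<Rightarrow> real ^ 4" +
  fixes rot :: "real ^ 4 ^ 4"
  assumes rotation: "rotation_matrix rot"
    and off_pole: "z \<in> sphere 0 1 \<Longrightarrow> (rot *v K i z) $ 4 \<noteq> 1"
begin

text \<open>The point of the link with parameter \<open>z\<close> on the component \<open>i\<close> is encoded by \<open>(i, z)\<close>.\<close>

definition points :: "('m \<times> complex) set" where
  "points = UNIV \<times> sphere 0 1"

definition plane :: "'m \<times> complex \<Rightarrow> complex" where
  "plane x = stereo_plane (rot *v K (fst x) (snd x))"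

definition height :: "'m \<times> complex \<Rightarrow> real" where
  "height x = stereo_height (rot *v K (fst x) (snd x))"

definition shift :: "'m \<times> complex \<Rightarrow> real \<Rightarrow> 'm \<times> complex" where
  "shift x s = (fst x, snd x * cis s)"

definition velocity :: "'m \<times> complex \<Rightarrow> complex" where
  "velocity x = vector_derivative (\<lambda>s. plane (shift x s)) (at 0)"

definition fibre :: "complex \<Rightarrow> ('m \<times> complex) set" where
  "fibre q = {x \<in> points. plane x = q}"

definition crossings :: "complex set" where
  "crossings = {q. \<exists>x\<in>fibre q. \<exists>y\<in>fibre q. x \<noteq> y}"

definition over_point :: "complex \<Rightarrow> 'm \<times> complex" where
  "over_point q = (THE x. x \<in> fibre q \<and> (\<forall>y\<in>fibre q. height y \<le> height x))"

definition under_point :: "complex \<Rightarrow> 'm \<times> complex" where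
  "under_point q = (THE x. x \<in> fibre q \<and> (\<forall>y\<in>fibre q. height x \<le> height y))"

end

text \<open>
  For complex numbers \<open>v\<close>, \<open>w\<close> the determinant of the pair \<open>(v, w)\<close> of plane vectors is
  \<open>Im (cnj v * w)\<close>; it is positive iff \<open>w\<close> points to the left of \<open>v\<close>.
\<close>

locale regular_projection = link_projection K rot
  for K :: "'m::finite \<Rightarrow> complex \<Rightarrow> real ^ 4" and rot +
  assumes immersed: "piecewise_smooth_circle (\<lambda>z. plane (i, z))"
    and finite_crossings: "finite crossings"
    and double: "q \<in> crossings \<Longrightarrow> card (fibre q) = 2"
    and smooth_at_crossings:
      "q \<in> crossings \<Longrightarrow> x \<in> fibre q \<Longrightarrow> (\<lambda>s. plane (shift x s)) differentiable at 0"
    and transverse: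
      "q \<in> crossings \<Longrightarrow> x \<in> fibre q \<Longrightarrow> y \<in> fibre q \<Longrightarrow> x \<noteq> y \<Longrightarrow>
         Im (cnj (velocity x) * velocity y) \<noteq> 0"

text \<open>
  At a crossing \<open>q\<close> the open segment of the underpassing strand with parameters at angle
  less than \<open>gap q\<close> from the crossing is removed. The segments are short enough that their
  closures are disjoint and meet no crossing other than their own.
\<close>

locale link_diagram = regular_projection K rot
  for K :: "'m::finite \<Rightarrow> complex \<Rightarrow> real ^ 4" and rot +
  fixes gap :: "complex \<Rightarrow> real"
  assumes gap_bounds: "q \<in> crossings \<Longrightarrow> 0 < gap q \<and> gap q < pi"
    and gaps_disjoint:
      "q \<in> crossings \<Longrightarrow> q' \<in> crossings \<Longrightarrow> q \<noteq> q' \<Longrightarrow>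
         shift (under_point q) ` {- gap q..gap q} \<inter> shift (under_point q') ` {- gap q'..gap q'} = {}"
    and gap_own_crossing:
      "q \<in> crossings \<Longrightarrow> q' \<in> crossings \<Longrightarrow> x \<in> fibre q' \<Longrightarrow>
         x \<in> shift (under_point q) ` {- gap q..gap q} \<Longrightarrow> x = under_point q"
begin

definition kept :: "('m \<times> complex) set" where
  "kept = points - (\<Union>q\<in>crossings. shift (under_point q) ` {- gap q<..<gap q})"

definition diagram :: "complex set" where
  "diagram = plane ` kept"

definition arcs :: "complex set set" where
  "arcs = components diagram"

text \<open>
  The diagram is the disjoint union of the parts contributed by the components of the link,
  because the removed segments leave only one preimage of each crossing.
\<close>

definition arc_index :: "complex set \<Rightarrow> 'm" where
  "arc_index a = (THE i. a \<subseteq> plane ` {x \<in> kept. fst x = i})"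

definition over_arc :: "complex \<Rightarrow> complex set" where
  "over_arc q = connected_component_set diagram q"

definition under_arc_before :: "complex \<Rightarrow> complex set" where
  "under_arc_before q = connected_component_set diagram (plane (shift (under_point q) (- gap q)))"

definition under_arc_after :: "complex \<Rightarrow> complex set" where
  "under_arc_after q = connected_component_set diagram (plane (shift (under_point q) (gap q)))"

definition under_arc_right :: "complex \<Rightarrow> complex set" where
  "under_arc_right q =
     (if Im (cnj (velocity (over_point q)) * velocity (under_point q)) > 0
      then under_arc_before q else under_arc_after q)"

definition under_arc_left :: "complex \<Rightarrow> complex set" where
  "under_arc_left q =
     (if Im (cnj (velocity (over_point q)) * velocity (under_point q)) > 0
      then under_arc_after q else under_arc_before q)"


section \<open>The Alexander module\<close>

abbreviation arc_module :: "('m laurent, complex set \<Rightarrow> 'm laurent) module" where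
  "arc_module \<equiv> free_module laurent_ring arcs"

abbreviation crossing_module :: "('m laurent, complex \<Rightarrow> 'm laurent) module" where
  "crossing_module \<equiv> free_module laurent_ring crossings"

definition crossing_relation :: "complex \<Rightarrow> complex set \<Rightarrow> 'm laurent" where
  "crossing_relation c =
     (let a1 = over_arc c; a2 = under_arc_right c; a3 = under_arc_left c in
       ((\<one>\<^bsub>laurent_ring\<^esub> \<ominus>\<^bsub>laurent_ring\<^esub> tvar (arc_index a2)) \<odot>\<^bsub>arc_module\<^esub> basis_vec laurent_ring a1
        \<oplus>\<^bsub>arc_module\<^esub> tvar (arc_index a1) \<odot>\<^bsub>arc_module\<^esub> basis_vec laurent_ring a2)
        \<ominus>\<^bsub>arc_module\<^esub> basis_vec laurent_ring a3)"

definition rho :: "(complex \<Rightarrow> 'm laurent) \<Rightarrow> complex set \<Rightarrow> 'm laurent" where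
  "rho f = (\<Oplus>\<^bsub>arc_module\<^esub>c\<in>crossings. f c \<odot>\<^bsub>arc_module\<^esub> crossing_relation c)"

definition alexander_module ::
  "('m laurent, (complex set \<Rightarrow> 'm laurent) set) module" where
  "alexander_module = quotient_module arc_module (rho ` carrier crossing_module)"

definition gamma :: "(complex set \<Rightarrow> 'm laurent) \<Rightarrow> (complex set \<Rightarrow> 'm laurent) set" where
  "gamma f = rho ` carrier crossing_module +>\<^bsub>arc_module\<^esub> f"

text \<open>The restriction to \<open>extensional\<close> maps makes the function unique outside the carrier.\<close>

definition phi :: "(complex set \<Rightarrow> 'm laurent) set \<Rightarrow> 'm laurent" where
  "phi = (THE \<phi>.
     \<phi> \<in> linear_maps laurent_ring alexander_module (ideal_module laurent_ring aug_ideal) \<and>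
     \<phi> ` carrier alexander_module = aug_ideal \<and>
     \<phi> \<in> extensional (carrier alexander_module) \<and>
     (\<forall>a\<in>arcs. \<phi> (gamma (basis_vec laurent_ring a)) =
        tvar (arc_index a) \<ominus>\<^bsub>laurent_ring\<^esub> \<one>\<^bsub>laurent_ring\<^esub>))"

end

end

theory Submission
  imports Defs
begin

text \<open>
  If \<open>f\<close> is a linear map from a module into an ideal, then \<open>f (x \<triangleright> y) = f x\<close>, so \<open>f\<close> is constant along
  the orbits of the operation and the quandle laws become identities of linear combinations in
  which the coefficients are fixed. What remains is that \<open>\<phi>\<^sub>L\<close>, a definite description, exists.
  The assignment \<open>a \<mapsto> t\<^bsub>\<kappa>(a)\<^esub> - 1\<close> kills every crossing relation as soon as the two underpassing arcs
  have equal index. For this, the images of the link components in the diagram are compact, since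
  open segments are removed from finitely many circles, and they are pairwise disjoint, since
  one of the two preimages of each crossing is removed; hence a connected subset of the diagram
  lies in exactly one of them, and \<open>\<kappa>\<close> of the arc through the image of a point is the component of that
  point. Surjectivity onto the ideal holds because every component retains a point: an end of
  a removed segment, or any point if nothing was removed.
\<close>

section \<open>Linear maps, free modules and quotient modules\<close>

lemma linear_mapsI:
  assumes "\<And>x. x \<in> carrier M \<Longrightarrow> f x \<in> carrier N"
    and "\<And>x y. x \<in> carrier M \<Longrightarrow> y \<in> carrier M \<Longrightarrow> f (x \<oplus>\<^bsub>M\<^esub> y) = f x \<oplus>\<^bsub>N\<^esub> f y"
    and "\<And>r x. r \<in> carrier R \<Longrightarrow> x \<in> carrier M \<Longrightarrow> f (r \<odot>\<^bsub>M\<^esub> x) = r \<odot>\<^bsub>N\<^esub> f x"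
  shows "f \<in> linear_maps R M N"
  using assms by (auto simp: linear_maps_def)

lemma linear_mapsD:
  assumes "f \<in> linear_maps R M N"
  shows linear_maps_closed: "x \<in> carrier M \<Longrightarrow> f x \<in> carrier N"
    and linear_maps_add: "x \<in> carrier M \<Longrightarrow> y \<in> carrier M \<Longrightarrow> f (x \<oplus>\<^bsub>M\<^esub> y) = f x \<oplus>\<^bsub>N\<^esub> f y"
    and linear_maps_smult: "r \<in> carrier R \<Longrightarrow> x \<in> carrier M \<Longrightarrow> f (r \<odot>\<^bsub>M\<^esub> x) = r \<odot>\<^bsub>N\<^esub> f x"
  using assms by (auto simp: linear_maps_def)

context
  fixes R :: "('r, 'k) ring_scheme" and M :: "('r, 'a, 'n) module_scheme"
    and N :: "('r, 'b, 'l) module_scheme" and f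
  assumes M: "module R M" and N: "module R N" and f: "f \<in> linear_maps R M N"
begin

interpretation M: module R M by (fact M)
interpretation N: module R N by (fact N)

lemma linear_maps_zero: "f \<zero>\<^bsub>M\<^esub> = \<zero>\<^bsub>N\<^esub>"
  using linear_maps_smult[OF f, of "\<zero>\<^bsub>R\<^esub>" "\<zero>\<^bsub>M\<^esub>"] linear_maps_closed[OF f, of "\<zero>\<^bsub>M\<^esub>"] by simp

lemma linear_maps_a_inv: "x \<in> carrier M \<Longrightarrow> f (\<ominus>\<^bsub>M\<^esub> x) = \<ominus>\<^bsub>N\<^esub> f x"
  using linear_maps_add[OF f, of "\<ominus>\<^bsub>M\<^esub> x" x] linear_maps_zero linear_maps_closed[OF f]
  by (metis M.M.a_inv_closed M.M.l_neg N.M.minus_equality)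

lemma linear_maps_minus:
  "x \<in> carrier M \<Longrightarrow> y \<in> carrier M \<Longrightarrow> f (x \<ominus>\<^bsub>M\<^esub> y) = f x \<ominus>\<^bsub>N\<^esub> f y"
  by (simp add: a_minus_def linear_maps_add[OF f] linear_maps_a_inv)

lemma linear_maps_finsum:
  assumes "finite A" "g \<in> A \<rightarrow> carrier M"
  shows "f (\<Oplus>\<^bsub>M\<^esub>i\<in>A. g i) = (\<Oplus>\<^bsub>N\<^esub>i\<in>A. f (g i))"
  using assms
proof (induction A)
  case empty
  then show ?case by (simp add: linear_maps_zero)
next
  case (insert a A)
  then have "(\<lambda>i. f (g i)) \<in> A \<rightarrow> carrier N" "f (g a) \<in> carrier N"
    using linear_maps_closed[OF f] by auto
  with insert show ?case
    by (simp add: linear_maps_add[OF f])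
qed

text \<open>This serves surjectivity of \<open>phi\<close>: the image turns out to be an ideal, so
  it suffices that it contains the generators of \<open>aug_ideal\<close>.\<close>

lemma linear_maps_image_submodule: "submodule (f ` carrier M) R N"
proof (rule N.submoduleI)
  show "f ` carrier M \<subseteq> carrier N"
    using linear_maps_closed[OF f] by auto
  show "\<zero>\<^bsub>N\<^esub> \<in> f ` carrier M"
    using linear_maps_zero by (auto intro: image_eqI[OF sym])
next
  fix a assume "a \<in> f ` carrier M"
  then show "\<ominus>\<^bsub>N\<^esub> a \<in> f ` carrier M"
    by (auto simp: linear_maps_a_inv[symmetric])
next
  fix a b assume "a \<in> f ` carrier M" "b \<in> f ` carrier M"
  then show "a \<oplus>\<^bsub>N\<^esub> b \<in> f ` carrier M"
    by (auto simp: linear_maps_add[OF f, symmetric])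
next
  fix a x assume "a \<in> carrier R" "x \<in> f ` carrier M"
  then show "a \<odot>\<^bsub>N\<^esub> x \<in> f ` carrier M"
    by (auto simp: linear_maps_smult[OF f, symmetric])
qed

end

lemma linear_maps_comp:
  assumes "f \<in> linear_maps R M N" "g \<in> linear_maps R N P"
  shows "(\<lambda>x. g (f x)) \<in> linear_maps R M P"
  using assms by (auto simp: linear_maps_def Pi_iff)

section \<open>Ideals as modules\<close>

lemma ideal_module_module:
  assumes "cring R" "ideal I R"
  shows "module R (ideal_module R I)"
proof -
  interpret cring R by fact
  interpret ideal I R by fact
  have [simp]: "\<And>x. x \<in> I \<Longrightarrow> x \<in> carrier R" by (rule a_Hcarr)
  show ?thesis
  proof (rule moduleI)
    show "abelian_group (ideal_module R I)"
    proof (rule abelian_groupI)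
      fix x assume "x \<in> carrier (ideal_module R I)"
      then show "\<exists>y\<in>carrier (ideal_module R I).
          y \<oplus>\<^bsub>ideal_module R I\<^esub> x = \<zero>\<^bsub>ideal_module R I\<^esub>"
        by (intro bexI[of _ "\<ominus>\<^bsub>R\<^esub> x"]) (auto simp: ideal_module_def l_neg)
    qed (auto simp: ideal_module_def a_ac)
  qed (auto simp: ideal_module_def l_distr r_distr m_assoc I_l_closed \<open>cring R\<close>)
qed

lemma ideal_module_simps:
  "carrier (ideal_module R I) = I"
  "x \<oplus>\<^bsub>ideal_module R I\<^esub> y = x \<oplus>\<^bsub>R\<^esub> y"
  "r \<odot>\<^bsub>ideal_module R I\<^esub> x = r \<otimes>\<^bsub>R\<^esub> x"
  "\<zero>\<^bsub>ideal_module R I\<^esub> = \<zero>\<^bsub>R\<^esub>"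
  by (simp_all add: ideal_module_def)

text \<open>Each structure takes negatives within its own carrier, so the inverse of
  \<open>y\<close> in \<open>I\<close> has to be identified with the one in \<open>R\<close> before
  differences can be compared.\<close>

lemma ideal_module_minus:
  assumes "cring R" "ideal I R" "x \<in> I" "y \<in> I"
  shows "x \<ominus>\<^bsub>ideal_module R I\<^esub> y = x \<ominus>\<^bsub>R\<^esub> y"
proof -
  interpret cring R by fact
  interpret I: ideal I R by fact
  interpret M: module R "ideal_module R I" using assms(1,2) by (rule ideal_module_module)
  have "\<ominus>\<^bsub>ideal_module R I\<^esub> y = \<ominus>\<^bsub>R\<^esub> y"
    using assms(4) I.a_Hcarr[OF assms(4)]
    by (intro M.M.minus_equality) (auto simp: ideal_module_simps l_neg)
  then show ?thesis by (simp add: a_minus_def ideal_module_simps)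
qed

text \<open>Makes the minimality of a generated ideal applicable to the image of a linear map.
  Commutativity turns the one-sided scalar action into closure on both sides.\<close>

lemma submodule_ideal_module_imp_ideal:
  assumes "cring R" "ideal I R" "submodule H R (ideal_module R I)"
  shows "ideal H R"
proof -
  interpret cring R by fact
  interpret I: ideal I R by fact
  interpret M: module R "ideal_module R I" using assms(1,2) by (rule ideal_module_module)
  note sub = M.submoduleE[OF assms(3), unfolded ideal_module_simps]
  have HR: "x \<in> carrier R" if "x \<in> H" for x
    using that sub(1) I.a_Hcarr by blast
  \<comment> \<open>Zero and negatives are obtained as multiples by the scalars 0 and -1.\<close>
  have zero: "\<zero>\<^bsub>R\<^esub> \<in> H"
    using sub(2) sub(4)[of "\<zero>\<^bsub>R\<^esub>"] HR by force
  have neg: "\<ominus>\<^bsub>R\<^esub> x \<in> H" if "x \<in> H" for x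
    using sub(4)[of "\<ominus>\<^bsub>R\<^esub> \<one>\<^bsub>R\<^esub>" x] that HR[OF that] by (simp add: l_minus)
  show ?thesis
  proof (rule idealI[OF ring_axioms])
    show "subgroup H (add_monoid R)"
      using HR zero neg sub(5) by (intro add.subgroupI) auto
    show "x \<otimes>\<^bsub>R\<^esub> a \<in> H" "a \<otimes>\<^bsub>R\<^esub> x \<in> H" if "a \<in> H" "x \<in> carrier R" for a x
      using sub(4)[OF that(2,1)] m_comm[OF that(2) HR[OF that(1)]] by simp_all
  qed
qed

section \<open>Free modules and their universal property\<close>

lemma free_module_module:
  assumes "cring R"
  shows "module R (free_module R B)"
proof -
  interpret cring R by fact
  let ?F = "free_module R B"
  \<comment> \<open>One support argument covers all operations: the support of \<open>h\<close> lies
    in the union of the supports of \<open>f\<close> and \<open>g\<close>. Negatives and scalar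
    multiples are the case \<open>f = g\<close>.\<close>
  have closed: "h \<in> carrier ?F"
    if "\<And>b. h b \<in> carrier R" "\<And>b. h b \<noteq> \<zero>\<^bsub>R\<^esub> \<Longrightarrow> f b \<noteq> \<zero>\<^bsub>R\<^esub> \<or> g b \<noteq> \<zero>\<^bsub>R\<^esub>"
      "f \<in> carrier ?F" "g \<in> carrier ?F" for f g h
  proof -
    have "{b. h b \<noteq> \<zero>\<^bsub>R\<^esub>} \<subseteq> {b. f b \<noteq> \<zero>\<^bsub>R\<^esub>} \<union> {b. g b \<noteq> \<zero>\<^bsub>R\<^esub>}"
      using that by auto
    moreover have "finite ({b. f b \<noteq> \<zero>\<^bsub>R\<^esub>} \<union> {b. g b \<noteq> \<zero>\<^bsub>R\<^esub>})"
        "{b. f b \<noteq> \<zero>\<^bsub>R\<^esub>} \<union> {b. g b \<noteq> \<zero>\<^bsub>R\<^esub>} \<subseteq> B"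
      using that by (auto simp: free_module_def)
    ultimately show ?thesis
      using that(1) by (auto simp: free_module_def intro: finite_subset)
  qed
  have val: "f b \<in> carrier R" if "f \<in> carrier ?F" for f b
    using that by (simp add: free_module_def)
  have add: "(f \<oplus>\<^bsub>?F\<^esub> g) = (\<lambda>b. f b \<oplus>\<^bsub>R\<^esub> g b)" for f g
    by (simp add: free_module_def)
  have smult: "(r \<odot>\<^bsub>?F\<^esub> g) = (\<lambda>b. r \<otimes>\<^bsub>R\<^esub> g b)" for r g
    by (simp add: free_module_def)
  have zero: "\<zero>\<^bsub>?F\<^esub> = (\<lambda>b. \<zero>\<^bsub>R\<^esub>)" by (simp add: free_module_def)
  show ?thesis
  proof (rule moduleI)
    show "abelian_group ?F"
    proof (rule abelian_groupI)
      fix f g assume fg: "f \<in> carrier ?F" "g \<in> carrier ?F"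
      show "f \<oplus>\<^bsub>?F\<^esub> g \<in> carrier ?F"
        by (rule closed[OF _ _ fg]) (auto simp: add val fg)
    next
      show "\<zero>\<^bsub>?F\<^esub> \<in> carrier ?F"
        by (simp add: free_module_def)
    next
      fix f assume f: "f \<in> carrier ?F"
      have "(\<lambda>b. \<ominus>\<^bsub>R\<^esub> f b) \<in> carrier ?F"
        by (rule closed[OF _ _ f f]) (auto simp: val f)
      then show "\<exists>g\<in>carrier ?F. g \<oplus>\<^bsub>?F\<^esub> f = \<zero>\<^bsub>?F\<^esub>"
        using f by (intro bexI[of _ "\<lambda>b. \<ominus>\<^bsub>R\<^esub> f b"]) (auto simp: add zero val l_neg)
    qed (auto simp: add zero val a_ac)
  next
    fix r f assume rf: "r \<in> carrier R" "f \<in> carrier ?F"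
    show "r \<odot>\<^bsub>?F\<^esub> f \<in> carrier ?F"
      by (rule closed[OF _ _ rf(2) rf(2)]) (use rf in \<open>auto simp: smult val\<close>)
  qed (auto simp: add smult val l_distr r_distr m_assoc \<open>cring R\<close>)
qed

lemma basis_vec_closed:
  assumes "cring R" "b \<in> B"
  shows "basis_vec R b \<in> carrier (free_module R B)"
proof -
  interpret cring R by fact
  show ?thesis using assms(2)
    by (auto simp: free_module_def basis_vec_def intro: finite_subset[of _ "{b}"])
qed

lemma free_module_maps_eqI:
  assumes R: "cring R" and P: "module R P"
    and f: "f \<in> linear_maps R (free_module R B) P"
    and g: "g \<in> linear_maps R (free_module R B) P"
    and eq: "\<And>b. b \<in> B \<Longrightarrow> f (basis_vec R b) = g (basis_vec R b)"
    and x: "x \<in> carrier (free_module R B)"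
  shows "f x = g x"
proof -
  interpret cring R by fact
  interpret F: module R "free_module R B" by (rule free_module_module[OF R])
  \<comment> \<open>The induction runs over a finite set containing the support, with
    \<open>x\<close> arbitrary, so the new index may also carry a zero coordinate.\<close>
  have "x \<in> carrier (free_module R B) \<Longrightarrow> {b. x b \<noteq> \<zero>\<^bsub>R\<^esub>} \<subseteq> S \<Longrightarrow> f x = g x" if "finite S" for S
    using that
  proof (induction S arbitrary: x)
    case empty
    then have "x = \<zero>\<^bsub>free_module R B\<^esub>" by (auto simp: free_module_def)
    then show ?case
      by (simp add: linear_maps_zero[OF F.module_axioms P f] linear_maps_zero[OF F.module_axioms P g])
  next
    case (insert b S)
    show ?case
    proof (cases "x b = \<zero>\<^bsub>R\<^esub>")
      case True
      then have "{b. x b \<noteq> \<zero>\<^bsub>R\<^esub>} \<subseteq> S" using insert.prems(2) by auto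
      then show ?thesis using insert by blast
    next
      case False
      \<comment> \<open>Erasing the coordinate at \<open>b\<close> leaves a vector supported in
        \<open>S\<close>, and \<open>x\<close> is that vector plus \<open>x b\<close> times the
        basis vector at \<open>b\<close>.\<close>
      define y where "y = x(b := \<zero>\<^bsub>R\<^esub>)"
      have val: "x c \<in> carrier R" for c using insert.prems by (simp add: free_module_def)
      have b: "b \<in> B" using False insert.prems by (auto simp: free_module_def)
      have sub: "{c. y c \<noteq> \<zero>\<^bsub>R\<^esub>} \<subseteq> {c. x c \<noteq> \<zero>\<^bsub>R\<^esub>}" by (auto simp: y_def)
      have y: "y \<in> carrier (free_module R B)"
        using insert.prems(1) finite_subset[OF sub] sub val
        by (auto simp: free_module_def y_def)
      have "{c. y c \<noteq> \<zero>\<^bsub>R\<^esub>} \<subseteq> S" using insert.prems(2) by (auto simp: y_def)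
      then have IH: "f y = g y" using insert.IH y by blast
      have bv: "basis_vec R b \<in> carrier (free_module R B)" by (rule basis_vec_closed[OF R b])
      have "x = y \<oplus>\<^bsub>free_module R B\<^esub> x b \<odot>\<^bsub>free_module R B\<^esub> basis_vec R b"
        using val by (auto simp: free_module_def basis_vec_def y_def fun_eq_iff)
      then show ?thesis
        using IH eq[OF b] bv y val
        by (metis F.smult_closed linear_maps_add[OF f] linear_maps_smult[OF f]
            linear_maps_add[OF g] linear_maps_smult[OF g])
    qed
  qed
  then show ?thesis using x by (auto simp: free_module_def)
qed

text \<open>Used both for \<open>rho\<close>, which sums over the finite set of crossings, and for
  the extension of a map from a basis, restricted to finite parts of the basis.\<close>

lemma linear_combination_linear:
  assumes P: "module R P" and B: "finite B" and v: "v \<in> B \<rightarrow> carrier P"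
  shows "(\<lambda>x. \<Oplus>\<^bsub>P\<^esub>b\<in>B. x b \<odot>\<^bsub>P\<^esub> v b) \<in> linear_maps R (free_module R B) P"
proof -
  interpret P: module R P by fact
  have val: "x b \<in> carrier R" if "x \<in> carrier (free_module R B)" for x b
    using that by (simp add: free_module_def)
  have cl: "(\<lambda>b. x b \<odot>\<^bsub>P\<^esub> v b) \<in> B \<rightarrow> carrier P" if "x \<in> carrier (free_module R B)" for x
    using v val[OF that] by auto
  show ?thesis
  proof (rule linear_mapsI)
    fix x assume x: "x \<in> carrier (free_module R B)"
    show "(\<Oplus>\<^bsub>P\<^esub>b\<in>B. x b \<odot>\<^bsub>P\<^esub> v b) \<in> carrier P"
      using cl[OF x] by (rule P.M.finsum_closed)
  next
    fix x y assume xy: "x \<in> carrier (free_module R B)" "y \<in> carrier (free_module R B)"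
    have add: "(x \<oplus>\<^bsub>free_module R B\<^esub> y) b \<odot>\<^bsub>P\<^esub> v b = x b \<odot>\<^bsub>P\<^esub> v b \<oplus>\<^bsub>P\<^esub> y b \<odot>\<^bsub>P\<^esub> v b"
      if "b \<in> B" for b
      using P.smult_l_distr[OF val[OF xy(1)] val[OF xy(2)]] that v by (simp add: free_module_def Pi_iff)
    have "(\<Oplus>\<^bsub>P\<^esub>b\<in>B. (x \<oplus>\<^bsub>free_module R B\<^esub> y) b \<odot>\<^bsub>P\<^esub> v b)
        = (\<Oplus>\<^bsub>P\<^esub>b\<in>B. x b \<odot>\<^bsub>P\<^esub> v b \<oplus>\<^bsub>P\<^esub> y b \<odot>\<^bsub>P\<^esub> v b)"
      using cl xy add by (intro P.M.finsum_cong') auto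
    also have "\<dots> = (\<Oplus>\<^bsub>P\<^esub>b\<in>B. x b \<odot>\<^bsub>P\<^esub> v b) \<oplus>\<^bsub>P\<^esub> (\<Oplus>\<^bsub>P\<^esub>b\<in>B. y b \<odot>\<^bsub>P\<^esub> v b)"
      using cl xy by (intro P.M.finsum_addf) auto
    finally show "(\<Oplus>\<^bsub>P\<^esub>b\<in>B. (x \<oplus>\<^bsub>free_module R B\<^esub> y) b \<odot>\<^bsub>P\<^esub> v b)
        = (\<Oplus>\<^bsub>P\<^esub>b\<in>B. x b \<odot>\<^bsub>P\<^esub> v b) \<oplus>\<^bsub>P\<^esub> (\<Oplus>\<^bsub>P\<^esub>b\<in>B. y b \<odot>\<^bsub>P\<^esub> v b)" .
  next
    fix r x assume rx: "r \<in> carrier R" "x \<in> carrier (free_module R B)"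
    have smult: "(r \<odot>\<^bsub>free_module R B\<^esub> x) b \<odot>\<^bsub>P\<^esub> v b = r \<odot>\<^bsub>P\<^esub> (x b \<odot>\<^bsub>P\<^esub> v b)"
      if "b \<in> B" for b
      using P.smult_assoc1[OF rx(1) val[OF rx(2)]] that v by (simp add: free_module_def Pi_iff)
    have "(\<Oplus>\<^bsub>P\<^esub>b\<in>B. (r \<odot>\<^bsub>free_module R B\<^esub> x) b \<odot>\<^bsub>P\<^esub> v b)
        = (\<Oplus>\<^bsub>P\<^esub>b\<in>B. r \<odot>\<^bsub>P\<^esub> (x b \<odot>\<^bsub>P\<^esub> v b))"
      using cl rx smult by (intro P.M.finsum_cong') auto
    also have "\<dots> = r \<odot>\<^bsub>P\<^esub> (\<Oplus>\<^bsub>P\<^esub>b\<in>B. x b \<odot>\<^bsub>P\<^esub> v b)"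
      using cl rx by (simp add: P.finsum_smult_ldistr B)
    finally show "(\<Oplus>\<^bsub>P\<^esub>b\<in>B. (r \<odot>\<^bsub>free_module R B\<^esub> x) b \<odot>\<^bsub>P\<^esub> v b)
        = r \<odot>\<^bsub>P\<^esub> (\<Oplus>\<^bsub>P\<^esub>b\<in>B. x b \<odot>\<^bsub>P\<^esub> v b)" .
  qed
qed

lemma free_module_extension:
  assumes P: "module R P" and v: "v \<in> B \<rightarrow> carrier P"
  obtains f where "f \<in> linear_maps R (free_module R B) P"
    "\<And>b. b \<in> B \<Longrightarrow> f (basis_vec R b) = v b"
proof
  interpret P: module R P by fact
  let ?F = "free_module R B"
  \<comment> \<open>The basis may be infinite, so the sum runs over the support of the argument. By
    \<open>eq\<close> any finite subset of \<open>B\<close> containing the support gives the same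
    value, and linearity is inherited from such sums.\<close>
  define f where "f x = (\<Oplus>\<^bsub>P\<^esub>b\<in>{b. x b \<noteq> \<zero>\<^bsub>R\<^esub>}. x b \<odot>\<^bsub>P\<^esub> v b)" for x
  have eq: "f x = (\<Oplus>\<^bsub>P\<^esub>b\<in>A. x b \<odot>\<^bsub>P\<^esub> v b)"
    if "x \<in> carrier ?F" "finite A" "A \<subseteq> B" "{b. x b \<noteq> \<zero>\<^bsub>R\<^esub>} \<subseteq> A" for x A
    unfolding f_def
    by (rule P.M.add.finprod_mono_neutral_cong_left)
      (use that v in \<open>auto simp: free_module_def subset_iff Pi_iff\<close>)
  have restrict: "x \<in> carrier (free_module R A)"
    if "x \<in> carrier ?F" "{b. x b \<noteq> \<zero>\<^bsub>R\<^esub>} \<subseteq> A" for x A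
    using that by (auto simp: free_module_def)
  have lin: "(\<lambda>x. \<Oplus>\<^bsub>P\<^esub>b\<in>A. x b \<odot>\<^bsub>P\<^esub> v b) \<in> linear_maps R (free_module R A) P"
    if "finite A" "A \<subseteq> B" for A
    using that v by (intro linear_combination_linear[OF P]) auto
  interpret F: module R ?F by (rule free_module_module) unfold_locales
  show "f \<in> linear_maps R ?F P"
  proof (rule linear_mapsI)
    fix x assume x: "x \<in> carrier ?F"
    show "f x \<in> carrier P"
      unfolding f_def by (rule P.M.finsum_closed) (use x v in \<open>auto simp: free_module_def\<close>)
  next
    fix x y assume xy: "x \<in> carrier ?F" "y \<in> carrier ?F"
    \<comment> \<open>Cancellation can make the support of the sum smaller than this union, so all
      three values are rewritten as sums over \<open>A\<close>.\<close>
    define A where "A = {b. x b \<noteq> \<zero>\<^bsub>R\<^esub>} \<union> {b. y b \<noteq> \<zero>\<^bsub>R\<^esub>}"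
    have A: "finite A" "A \<subseteq> B" using xy by (auto simp: A_def free_module_def)
    have s: "{b. (x \<oplus>\<^bsub>?F\<^esub> y) b \<noteq> \<zero>\<^bsub>R\<^esub>} \<subseteq> A"
      by (auto simp: A_def free_module_def)
    \<comment> \<open>Addition is pointwise and does not depend on the basis, so the two sums are
      the same function.\<close>
    have [simp]: "x \<oplus>\<^bsub>?F\<^esub> y = x \<oplus>\<^bsub>free_module R A\<^esub> y" by (simp add: free_module_def)
    show "f (x \<oplus>\<^bsub>?F\<^esub> y) = f x \<oplus>\<^bsub>P\<^esub> f y"
      using eq[OF _ A, of x] eq[OF _ A, of y] eq[OF _ A s] F.M.a_closed[OF xy] xy
        linear_maps_add[OF lin[OF A], of x y] restrict[of x A] restrict[of y A]
      by (auto simp: A_def)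
  next
    fix r x assume rx: "r \<in> carrier R" "x \<in> carrier ?F"
    define A where "A = {b. x b \<noteq> \<zero>\<^bsub>R\<^esub>}"
    have A: "finite A" "A \<subseteq> B" using rx by (auto simp: A_def free_module_def)
    have s: "{b. (r \<odot>\<^bsub>?F\<^esub> x) b \<noteq> \<zero>\<^bsub>R\<^esub>} \<subseteq> A"
      using rx by (auto simp: A_def free_module_def)
    have [simp]: "r \<odot>\<^bsub>?F\<^esub> x = r \<odot>\<^bsub>free_module R A\<^esub> x" by (simp add: free_module_def)
    show "f (r \<odot>\<^bsub>?F\<^esub> x) = r \<odot>\<^bsub>P\<^esub> f x"
      using eq[OF _ A, of x] eq[OF _ A s] F.smult_closed[OF rx] rx
        linear_maps_smult[OF lin[OF A], of r x] restrict[of x A]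
      by (auto simp: A_def)
  qed
  show "f (basis_vec R b) = v b" if b: "b \<in> B" for b
  proof -
    \<comment> \<open>Summing over \<open>{b}\<close> instead of the support also covers the trivial
      ring, where the basis vector is zero.\<close>
    have "f (basis_vec R b) = (\<Oplus>\<^bsub>P\<^esub>c\<in>{b}. basis_vec R b c \<odot>\<^bsub>P\<^esub> v c)"
    proof (rule eq)
      show "basis_vec R b \<in> carrier ?F"
        using P.R.cring_axioms b by (rule basis_vec_closed)
    qed (use b in \<open>auto simp: basis_vec_def\<close>)
    then show ?thesis
      using b v by (simp add: basis_vec_def Pi_iff)
  qed
qed

section \<open>Quotient modules and their universal property\<close>

context
  fixes R :: "('r, 'k) ring_scheme" and M :: "('r, 'a, 'n) module_scheme" and N
  assumes M: "module R M" and N: "submodule N R M"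
begin

interpretation M: module R M by (fact M)
interpretation N: abelian_subgroup N M
  using N M.abelian_group_axioms
  by (intro abelian_subgroupI3 additive_subgroupI) (auto simp: submodule_def)

lemma quotient_module_carrier:
  "carrier (quotient_module M N) = (\<lambda>x. N +>\<^bsub>M\<^esub> x) ` carrier M"
  by (auto simp: quotient_module_def A_RCOSETS_def')

lemma quotient_module_add:
  assumes "x \<in> carrier M" "y \<in> carrier M"
  shows "(N +>\<^bsub>M\<^esub> x) \<oplus>\<^bsub>quotient_module M N\<^esub> (N +>\<^bsub>M\<^esub> y) = N +>\<^bsub>M\<^esub> (x \<oplus>\<^bsub>M\<^esub> y)"
  using assms by (simp add: quotient_module_def N.a_rcos_sum)

text \<open>Two representatives differ by some \<open>n\<close> in \<open>N\<close>, and their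
  multiples by \<open>r \<odot> n\<close>, again in \<open>N\<close>. All cosets in the defining
  union therefore coincide, and the representative \<open>x\<close> shows that the union is not
  empty.\<close>

lemma quotient_module_smult:
  assumes r: "r \<in> carrier R" and x: "x \<in> carrier M"
  shows "r \<odot>\<^bsub>quotient_module M N\<^esub> (N +>\<^bsub>M\<^esub> x) = N +>\<^bsub>M\<^esub> (r \<odot>\<^bsub>M\<^esub> x)"
proof -
  have "N +>\<^bsub>M\<^esub> (r \<odot>\<^bsub>M\<^esub> y) = N +>\<^bsub>M\<^esub> (r \<odot>\<^bsub>M\<^esub> x)" if y: "y \<in> N +>\<^bsub>M\<^esub> x" for y
  proof -
    obtain n where n: "n \<in> N" "y = n \<oplus>\<^bsub>M\<^esub> x" using y by (auto simp: a_r_coset_def')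
    have nM: "n \<in> carrier M" using n N.a_subset by auto
    have "r \<odot>\<^bsub>M\<^esub> y = r \<odot>\<^bsub>M\<^esub> n \<oplus>\<^bsub>M\<^esub> r \<odot>\<^bsub>M\<^esub> x"
      using n nM r x by (simp add: M.smult_r_distr)
    moreover have "r \<odot>\<^bsub>M\<^esub> n \<in> N" using n r M.submoduleE(4)[OF N] by blast
    ultimately have "r \<odot>\<^bsub>M\<^esub> y \<in> N +>\<^bsub>M\<^esub> (r \<odot>\<^bsub>M\<^esub> x)"
      by (auto simp: a_r_coset_def')
    then show ?thesis using N.a_repr_independence' r x by simp
  qed
  moreover have "x \<in> N +>\<^bsub>M\<^esub> x" using N.a_rcos_self x by simp
  ultimately have "(\<Union>y\<in>N +>\<^bsub>M\<^esub> x. N +>\<^bsub>M\<^esub> (r \<odot>\<^bsub>M\<^esub> y)) = N +>\<^bsub>M\<^esub> (r \<odot>\<^bsub>M\<^esub> x)"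
    by blast
  then show ?thesis by (simp add: quotient_module_def)
qed

lemma quotient_module_module: "module R (quotient_module M N)"
proof -
  let ?Q = "quotient_module M N"
  have cl: "C \<in> carrier ?Q \<Longrightarrow> \<exists>x\<in>carrier M. C = N +>\<^bsub>M\<^esub> x" for C
    by (auto simp: quotient_module_carrier)
  have zero: "\<zero>\<^bsub>?Q\<^esub> = N +>\<^bsub>M\<^esub> \<zero>\<^bsub>M\<^esub>"
    using N.a_subset by (simp add: quotient_module_def)
  note simps = quotient_module_add quotient_module_smult zero
  show ?thesis
  proof (rule moduleI)
    show "abelian_group ?Q"
    proof (rule abelian_groupI)
      fix C assume "C \<in> carrier ?Q"
      then obtain x where x: "x \<in> carrier M" "C = N +>\<^bsub>M\<^esub> x" using cl by blast
      then show "\<exists>D\<in>carrier ?Q. D \<oplus>\<^bsub>?Q\<^esub> C = \<zero>\<^bsub>?Q\<^esub>"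
        by (intro bexI[of _ "N +>\<^bsub>M\<^esub> (\<ominus>\<^bsub>M\<^esub> x)"]) (auto simp: simps M.M.l_neg quotient_module_carrier)
    qed (auto dest!: cl simp: simps M.M.a_ac, auto simp: quotient_module_carrier)
  qed (auto dest!: cl simp: simps M.smult_l_distr M.smult_r_distr M.smult_assoc1 M.R.cring_axioms,
      auto simp: quotient_module_carrier)
qed

lemma coset_linear: "(\<lambda>x. N +>\<^bsub>M\<^esub> x) \<in> linear_maps R M (quotient_module M N)"
  by (rule linear_mapsI) (auto simp: quotient_module_add quotient_module_smult quotient_module_carrier)

lemma quotient_module_extension:
  assumes P: "module R P" and f: "f \<in> linear_maps R M P"
    and ker: "\<And>n. n \<in> N \<Longrightarrow> f n = \<zero>\<^bsub>P\<^esub>"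
  obtains g where "g \<in> linear_maps R (quotient_module M N) P"
    "g \<in> extensional (carrier (quotient_module M N))"
    "\<And>x. x \<in> carrier M \<Longrightarrow> g (N +>\<^bsub>M\<^esub> x) = f x"
proof
  interpret P: module R P by fact
  let ?Q = "quotient_module M N"
  \<comment> \<open>The value is read off a chosen representative; the choice is irrelevant because
    \<open>f\<close> vanishes on \<open>N\<close>. The restricted abstraction gives
    extensionality.\<close>
  define g where "g = (\<lambda>C\<in>carrier ?Q. f (SOME x. x \<in> C))"
  show g: "g (N +>\<^bsub>M\<^esub> x) = f x" if x: "x \<in> carrier M" for x
  proof -
    have "f y = f x" if y: "y \<in> N +>\<^bsub>M\<^esub> x" for y
    proof -
      obtain n where n: "n \<in> N" "y = n \<oplus>\<^bsub>M\<^esub> x" using y by (auto simp: a_r_coset_def')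
      then show ?thesis
        using x N.a_subset ker[of n] linear_maps_closed[OF f x]
        by (auto simp: linear_maps_add[OF f] subset_iff)
    qed
    moreover have "(SOME y. y \<in> N +>\<^bsub>M\<^esub> x) \<in> N +>\<^bsub>M\<^esub> x"
      using N.a_rcos_self[OF x] by (rule someI)
    moreover have "N +>\<^bsub>M\<^esub> x \<in> carrier ?Q" using x by (simp add: quotient_module_carrier)
    ultimately show ?thesis by (simp add: g_def)
  qed
  show "g \<in> extensional (carrier ?Q)" by (simp add: g_def)
  show "g \<in> linear_maps R ?Q P"
    by (rule linear_mapsI)
      (auto simp: quotient_module_carrier quotient_module_add quotient_module_smult g
        linear_maps_closed[OF f] linear_maps_add[OF f] linear_maps_smult[OF f])
qed

end

section \<open>The quandle of a linear map into an ideal\<close>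

lemma quandle_of_linear_map:
  fixes R (structure) and M :: "('r, 'a, 'n) module_scheme"
  assumes M: "module R M" and I: "ideal I R" and f: "f \<in> linear_maps R M (ideal_module R I)"
  shows "quandle {x \<in> carrier M. f x \<oplus> \<one> \<in> Units R}
          (\<lambda>x y. ((f y \<oplus> \<one>) \<odot>\<^bsub>M\<^esub> x) \<ominus>\<^bsub>M\<^esub> (f x \<odot>\<^bsub>M\<^esub> y))
          (\<lambda>x y. inv (f y \<oplus> \<one>) \<odot>\<^bsub>M\<^esub> (x \<oplus>\<^bsub>M\<^esub> (f x \<odot>\<^bsub>M\<^esub> y)))"
proof -
  interpret M: module R M by fact
  interpret I: ideal I R by fact
  let ?U = "{x \<in> carrier M. f x \<oplus> \<one> \<in> Units R}"
  let ?rt = "\<lambda>x y. ((f y \<oplus> \<one>) \<odot>\<^bsub>M\<^esub> x) \<ominus>\<^bsub>M\<^esub> (f x \<odot>\<^bsub>M\<^esub> y)"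
  let ?rtinv = "\<lambda>x y. inv (f y \<oplus> \<one>) \<odot>\<^bsub>M\<^esub> (x \<oplus>\<^bsub>M\<^esub> (f x \<odot>\<^bsub>M\<^esub> y))"
  have P: "module R (ideal_module R I)"
    using M.R.cring_axioms I by (rule ideal_module_module)
  have f_closed [simp]: "f x \<in> carrier R" if "x \<in> carrier M" for x
    using linear_maps_closed[OF f that] I.a_Hcarr by (simp add: ideal_module_def)
  have f_add: "f (x \<oplus>\<^bsub>M\<^esub> y) = f x \<oplus> f y" if "x \<in> carrier M" "y \<in> carrier M" for x y
    using linear_maps_add[OF f that] by (simp add: ideal_module_def)
  have f_smult: "f (r \<odot>\<^bsub>M\<^esub> x) = r \<otimes> f x" if "r \<in> carrier R" "x \<in> carrier M" for r x
    using linear_maps_smult[OF f that] by (simp add: ideal_module_def)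
  have f_minus: "f (\<ominus>\<^bsub>M\<^esub> x) = \<ominus> f x" if "x \<in> carrier M" for x
    using f_smult[of "\<ominus> \<one>" x] that M.smult_l_minus[of "\<one>" x] by (simp add: M.R.l_minus)
  \<comment> \<open>The products of \<open>f x\<close> and \<open>f y\<close> cancel by
    commutativity. This invariance drives all the laws below.\<close>
  have f_rt: "f (?rt x y) = f x" if "x \<in> carrier M" "y \<in> carrier M" for x y
    using that
    by (simp add: a_minus_def f_add f_minus f_smult M.R.l_distr M.R.r_distr M.R.a_ac M.R.m_comm M.R.r_neg1 M.R.r_neg2 M.R.r_neg)
  have f_rtinv: "f (?rtinv x y) = f x"
    if "x \<in> carrier M" "y \<in> carrier M" "f y \<oplus> \<one> \<in> Units R" for x y
  proof -
    \<comment> \<open>The image of \<open>x + f x y\<close> is \<open>f x + f x f y\<close>, which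
      contains the factor \<open>f y + 1\<close> that the inverse cancels.\<close>
    have "f (?rtinv x y) = inv (f y \<oplus> \<one>) \<otimes> ((f y \<oplus> \<one>) \<otimes> f x)"
      using that by (simp add: f_add f_smult M.R.l_distr M.R.r_distr M.R.a_ac M.R.m_comm)
    then show ?thesis using that by (simp add: M.R.m_assoc[symmetric])
  qed
  have idem: "?rt x x = x" if "x \<in> carrier M" for x
    using that
    by (simp add: a_minus_def M.smult_l_distr M.M.a_ac M.M.r_neg1 M.M.r_neg2 M.M.r_neg)
  have rt_closed [simp]: "?rt x y \<in> carrier M" if "x \<in> carrier M" "y \<in> carrier M" for x y
    using that by (simp add: a_minus_def)
  have inv1: "?rtinv (?rt x y) y = x"
    if "x \<in> carrier M" "y \<in> carrier M" "f y \<oplus> \<one> \<in> Units R" for x y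
  proof -
    \<comment> \<open>As \<open>f\<close> has the same value at \<open>?rt x y\<close> and at
      \<open>x\<close>, the added term is the one subtracted in \<open>?rt x y\<close>.\<close>
    have "?rt x y \<oplus>\<^bsub>M\<^esub> (f (?rt x y) \<odot>\<^bsub>M\<^esub> y) = (f y \<oplus> \<one>) \<odot>\<^bsub>M\<^esub> x"
      using that by (simp add: f_rt) (simp add: a_minus_def M.M.a_assoc M.M.l_neg)
    then show ?thesis using that by (simp add: M.smult_assoc1[symmetric])
  qed
  have inv2: "?rt (?rtinv x y) y = x"
    if "x \<in> carrier M" "y \<in> carrier M" "f y \<oplus> \<one> \<in> Units R" for x y
  proof -
    have "(f y \<oplus> \<one>) \<odot>\<^bsub>M\<^esub> ?rtinv x y = x \<oplus>\<^bsub>M\<^esub> (f x \<odot>\<^bsub>M\<^esub> y)"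
      using that by (simp add: M.smult_assoc1[symmetric])
    then show ?thesis
      unfolding f_rtinv[OF that] using that by (simp add: a_minus_def M.M.a_assoc M.M.r_neg)
  qed
  have dist: "?rt (?rt x y) z = ?rt (?rt x z) (?rt y z)"
    if xyz [simp]: "x \<in> carrier M" "y \<in> carrier M" "z \<in> carrier M" for x y z
  proof -
    let ?x = "f x" and ?y = "f y" and ?z = "f z"
    have "?rt (?rt x y) z = (?z \<oplus> \<one>) \<odot>\<^bsub>M\<^esub> ?rt x y \<ominus>\<^bsub>M\<^esub> ?x \<odot>\<^bsub>M\<^esub> z"
      by (simp only: f_rt xyz)
    also have "\<dots> = ((?y \<oplus> \<one>) \<otimes> (?z \<oplus> \<one>)) \<odot>\<^bsub>M\<^esub> x \<ominus>\<^bsub>M\<^esub> (?x \<otimes> (?z \<oplus> \<one>)) \<odot>\<^bsub>M\<^esub> y \<ominus>\<^bsub>M\<^esub> ?x \<odot>\<^bsub>M\<^esub> z"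
      by (simp add: a_minus_def M.smult_r_distr M.smult_r_minus M.smult_assoc1[symmetric] M.R.m_comm)
    \<comment> \<open>On the right-hand side \<open>z\<close> enters through both
      \<open>?rt x z\<close> and \<open>?rt y z\<close>; its coefficient is split accordingly, using
      \<open>(f y + 1) f x - f x f y = f x\<close>.\<close>
    also have "?x \<odot>\<^bsub>M\<^esub> z = ((?y \<oplus> \<one>) \<otimes> ?x) \<odot>\<^bsub>M\<^esub> z \<ominus>\<^bsub>M\<^esub> (?x \<otimes> ?y) \<odot>\<^bsub>M\<^esub> z"
      by (simp add: a_minus_def M.R.l_distr M.R.r_distr M.smult_l_distr M.R.m_comm M.M.a_ac M.M.r_neg M.M.r_neg1 M.M.r_neg2)
    also have "((?y \<oplus> \<one>) \<otimes> (?z \<oplus> \<one>)) \<odot>\<^bsub>M\<^esub> x \<ominus>\<^bsub>M\<^esub> (?x \<otimes> (?z \<oplus> \<one>)) \<odot>\<^bsub>M\<^esub> y \<ominus>\<^bsub>M\<^esub>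
         (((?y \<oplus> \<one>) \<otimes> ?x) \<odot>\<^bsub>M\<^esub> z \<ominus>\<^bsub>M\<^esub> (?x \<otimes> ?y) \<odot>\<^bsub>M\<^esub> z) =
       (?y \<oplus> \<one>) \<odot>\<^bsub>M\<^esub> ?rt x z \<ominus>\<^bsub>M\<^esub> ?x \<odot>\<^bsub>M\<^esub> ?rt y z"
      by (simp add: a_minus_def M.smult_r_distr M.smult_r_minus M.smult_assoc1[symmetric]
          M.M.minus_add M.M.a_ac)
    also have "\<dots> = ?rt (?rt x z) (?rt y z)"
      by (simp only: f_rt xyz)
    finally show ?thesis .
  qed
  \<comment> \<open>Both operations preserve the value of \<open>f\<close> at the first argument, so
    the unit condition is preserved as well.\<close>
  show ?thesis
    unfolding quandle_def
    using f_rt f_rtinv idem inv1 inv2 dist by (auto simp: a_minus_def)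
qed

section \<open>The arcs of a link diagram\<close>

lemma cis_eq_imp_eq:
  assumes "cis s = cis t" "\<bar>s - t\<bar> < 2 * pi"
  shows "s = t"
proof -
  have "cis (s - t) = 1"
    using assms(1) by (simp flip: cis_divide)
  then have "cos (s - t) = 1" by (simp add: complex_eq_iff)
  then obtain n :: int where n: "s - t = n * 2 * pi"
    by (auto simp: cos_one_2pi_int)
  then have "\<bar>real_of_int n\<bar> < 1"
    using assms(2) by (simp add: abs_mult)
  then have "n = 0" by linarith
  then show ?thesis using n by simp
qed

text \<open>The complement is the arc traced by the angles from \<open>g\<close> to
  \<open>2 * pi - g\<close>, a continuous image of a compact interval.\<close>

lemma sphere_minus_open_arc_closed:
  assumes w: "w \<in> sphere (0::complex) 1" and g: "0 < g" "g < pi"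
  shows "closed (sphere 0 1 - (\<lambda>s. w * cis s) ` {- g<..<g})"
proof -
  have "sphere 0 1 - (\<lambda>s. w * cis s) ` {- g<..<g} = (\<lambda>s. w * cis s) ` {g..2 * pi - g}"
  proof (intro equalityI subsetI)
    fix z assume z: "z \<in> sphere 0 1 - (\<lambda>s. w * cis s) ` {- g<..<g}"
    define u where "u = z / w"
    have u: "norm u = 1" "z = w * u" using z w by (auto simp: u_def norm_divide)
    then have "u \<noteq> 0" by auto
    define t where "t = Arg u"
    have t: "cis t = u" "- pi < t" "t \<le> pi"
      using u(1) Arg_bounded[of u] cis_Arg[OF \<open>u \<noteq> 0\<close>] by (auto simp: t_def sgn_div_norm)
    have "t \<notin> {- g<..<g}" using z u(2) t(1) by auto
    then consider "g \<le> t" | "t \<le> - g" by force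
    then show "z \<in> (\<lambda>s. w * cis s) ` {g..2 * pi - g}"
    proof cases
      case 1
      then show ?thesis using t u  g by (intro image_eqI[of _ _ t]) auto
    next
      case 2
      \<comment> \<open>The principal argument lies above \<open>- pi\<close>; a full turn moves an
        angle of at most \<open>- g\<close> between \<open>pi\<close> and
        \<open>2 * pi - g\<close>.\<close>
      have "cis (t + 2 * pi) = u" using t by (simp flip: cis_mult)
      then show ?thesis using t u  g 2 by (intro image_eqI[of _ _ "t + 2 * pi"]) auto
    qed
  next
    fix z assume "z \<in> (\<lambda>s. w * cis s) ` {g..2 * pi - g}"
    then obtain t where t: "t \<in> {g..2 * pi - g}" "z = w * cis t" by auto
    have "z \<noteq> w * cis s" if "s \<in> {- g<..<g}" for s
    proof
      assume "z = w * cis s"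
      then have "cis s = cis t" using t w by auto
      \<comment> \<open>The angles differ by less than a full turn, since \<open>s > - g\<close> and
        \<open>t \<le> 2 * pi - g\<close>.\<close>
      then have "s = t" using t that  g by (intro cis_eq_imp_eq) auto
      then show False using t that by auto
    qed
    then show "z \<in> sphere 0 1 - (\<lambda>s. w * cis s) ` {- g<..<g}"
      using t w by (auto simp: norm_mult)
  qed
  moreover have "compact ((\<lambda>s. w * cis s) ` {g..2 * pi - g})"
    by (intro compact_continuous_image continuous_intros) auto
  ultimately show ?thesis by (simp add: compact_imp_closed)
qed

text \<open>As the index type is finite, the union of the other pieces is closed. It would separate
  \<open>S\<close> from \<open>P i\<close> if it met \<open>S\<close>.\<close>

lemma connected_subset_of_disjoint_closed_union:
  fixes P :: "'i::finite \<Rightarrow> 'a::topological_space set"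
  assumes "connected S" "S \<subseteq> (\<Union>i. P i)" "\<And>i. closed (P i)"
    and disj: "\<And>i j. i \<noteq> j \<Longrightarrow> P i \<inter> P j = {}"
    and x: "x \<in> S" "x \<in> P i"
  shows "S \<subseteq> P i"
proof -
  let ?Q = "\<Union>j\<in>- {i}. P j"
  have "closed ?Q" by (intro closed_UN) (use assms in auto)
  moreover have "S \<subseteq> P i \<union> ?Q" using assms(2) by auto
  moreover have "P i \<inter> ?Q \<inter> S = {}" using disj by auto
  ultimately have "?Q \<inter> S = {}"
    using connected_closedD[OF assms(1), of "P i" ?Q] x assms(3) by blast
  then show ?thesis using \<open>S \<subseteq> P i \<union> ?Q\<close> by blast
qed

lemma stereo_inj:
  fixes y z :: "real ^ 4"
  assumes "norm y = 1" "norm z = 1" "y $ 4 \<noteq> 1" "z $ 4 \<noteq> 1"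
    and "stereo_plane y = stereo_plane z" "stereo_height y = stereo_height z"
  shows "y = z"
proof -
  let ?c = "\<lambda>y :: real ^ 4. (\<lambda>i. y $ i / (1 - y $ 4))"
  \<comment> \<open>The inverse of stereographic projection: the equation of the sphere determines
    \<open>1 - y $ 4\<close> from the three projected coordinates. The first factor is positive,
    hence can be cancelled below.\<close>
  have *: "((?c y 1)\<^sup>2 + (?c y 2)\<^sup>2 + (?c y 3)\<^sup>2 + 1) * (1 - y $ 4) = 2"
    if "norm y = 1" "y $ 4 \<noteq> 1" for y :: "real ^ 4"
  proof -
    define s where "s = 1 - y $ 4"
    have s: "s \<noteq> 0" "y $ 4 = 1 - s" using that by (auto simp: s_def)
    have "(y $ 1)\<^sup>2 + (y $ 2)\<^sup>2 + (y $ 3)\<^sup>2 + (y $ 4)\<^sup>2 = 1"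
      using that(1) by (simp add: norm_eq_1 inner_vec_def sum_4 power2_eq_square)
    then have "(y $ 1)\<^sup>2 + (y $ 2)\<^sup>2 + (y $ 3)\<^sup>2 + s * s = 2 * s"
      by (simp add: s(2) power2_eq_square algebra_simps)
    then show ?thesis
      using s(1) unfolding s_def[symmetric]
      by (simp add: field_simps power2_eq_square)
  qed
  have c: "?c y 1 = ?c z 1" "?c y 2 = ?c z 2" "?c y 3 = ?c z 3"
    using assms(5,6) by (auto simp: stereo_plane_def stereo_height_def)
  have "(?c z 1)\<^sup>2 + (?c z 2)\<^sup>2 + (?c z 3)\<^sup>2 + 1 \<noteq> 0"
    by (smt (verit) zero_le_power2)
  then have "1 - y $ 4 = 1 - z $ 4"
    using *[OF assms(1,3)] *[OF assms(2,4)] unfolding c by (metis mult_left_cancel)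
  then have "y $ i = z $ i" for i
    using c assms(3,4) exhaust_4[of i] by auto
  then show ?thesis by (simp add: vec_eq_iff)
qed

section \<open>Points of the link and their projections\<close>

context link_projection
begin

lemma rot_orthogonal: "orthogonal_transformation ((*v) rot)"
  using rotation by (simp add: rotation_matrix_def orthogonal_transformation_matrix)

lemma norm_rot: "norm (rot *v v) = norm v"
  using rot_orthogonal by (rule orthogonal_transformation_norm)

text \<open>Stereographic projection and the rotation are injective, and the components are embedded
  and disjoint. Hence distinct points over the same point of the plane have distinct
  heights.\<close>

lemma points_eqI:
  assumes x: "x \<in> points" and y: "y \<in> points"
    and "plane x = plane y" "height x = height y"
  shows "x = y"
proof -
  let ?K = "\<lambda>x. K (fst x) (snd x)"
  have s: "snd x \<in> sphere 0 1" "snd y \<in> sphere 0 1" using x y by (auto simp: points_def)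
  then have "norm (?K x) = 1" "norm (?K y) = 1"
    using in_sphere by (metis image_subset_iff mem_sphere_0)+
  then have "rot *v ?K x = rot *v ?K y"
    using assms s off_pole by (intro stereo_inj) (auto simp: plane_def height_def norm_rot)
  then have eq: "?K x = ?K y"
    using orthogonal_transformation_inj[OF rot_orthogonal] by (simp add: inj_eq)
  then have "fst x = fst y"
    using disjoint[of "fst x" "fst y"] s by blast
  then show ?thesis
    using eq injective s by (metis inj_onD prod_eqI)
qed

lemma plane_continuous: "continuous_on (sphere 0 1) (\<lambda>z. plane (i, z))"
proof -
  have c: "continuous_on (sphere 0 1) (\<lambda>z. rot *v K i z)"
    by (intro linear_continuous_on_compose[OF continuous] matrix_vector_mul_linear)
  have "continuous_on (sphere 0 1) (\<lambda>z. (rot *v K i z) $ j)" for j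
    using c by (rule continuous_on_component)
  then show ?thesis
    unfolding plane_def stereo_plane_def Complex_eq fst_conv snd_conv
    by (intro continuous_intros) (use off_pole c in auto)
qed

lemma shift_in_points: "x \<in> points \<Longrightarrow> shift x s \<in> points"
  by (auto simp: points_def shift_def norm_mult)

lemma shift_0 [simp]: "shift x 0 = x"
  by (simp add: shift_def)

lemma fst_shift [simp]: "fst (shift x s) = fst x"
  by (simp add: shift_def)

end

section \<open>The two preimages of a crossing\<close>

context regular_projection
begin

text \<open>The two preimages differ in height, so the definite descriptions of the highest and the
  lowest one are meaningful.\<close>

lemma crossing_points:
  assumes q: "q \<in> crossings"
  shows fibre_crossing: "fibre q = {over_point q, under_point q}"
    and over_point_neq_under_point: "over_point q \<noteq> under_point q"
proof -
  obtain x y where xy: "fibre q = {x, y}" "height y < height x"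
  proof -
    obtain x y where "fibre q = {x, y}" "x \<noteq> y"
      using double[OF q] by (auto simp: card_2_iff)
    moreover from this have "x \<in> fibre q" "y \<in> fibre q" by auto
    then have "x \<in> points" "y \<in> points" "plane x = plane y" by (auto simp: fibre_def)
    ultimately have "fibre q = {x, y}" "height x \<noteq> height y"
      using points_eqI[of x y] by auto
    then show thesis
      using that[of x y] that[of y x] by (metis insert_commute linorder_neqE)
  qed
  have "over_point q = x" "under_point q = y"
    unfolding over_point_def under_point_def xy(1) using xy(2) by (auto intro!: the_equality)
  then show "fibre q = {over_point q, under_point q}" "over_point q \<noteq> under_point q"
    using xy by auto
qed

lemma crossing_points_in_fibre:
  assumes "q \<in> crossings"
  shows "over_point q \<in> fibre q" "under_point q \<in> fibre q"
  using fibre_crossing[OF assms] by auto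

end

section \<open>Kept points and the index of an arc\<close>

context link_diagram
begin

text \<open>Two distinct points with the same image are the preimages of a crossing. One of them is
  the under point, which is removed because it has parameter 0 in its own segment.\<close>

lemma kept_inj:
  assumes x: "x \<in> kept" and y: "y \<in> kept" and eq: "plane x = plane y"
  shows "x = y"
proof (rule ccontr)
  assume "x \<noteq> y"
  have "x \<in> fibre (plane x)" "y \<in> fibre (plane x)"
    using x y eq by (auto simp: fibre_def kept_def)
  with \<open>x \<noteq> y\<close> have q: "plane x \<in> crossings" by (auto simp: crossings_def)
  have "under_point (plane x) = x \<or> under_point (plane x) = y"
    using fibre_crossing[OF q] \<open>x \<in> fibre _\<close> \<open>y \<in> fibre _\<close> \<open>x \<noteq> y\<close> by auto
  moreover have "under_point (plane x) \<notin> kept"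
    using q gap_bounds[OF q] unfolding kept_def by (force intro: image_eqI[of _ _ 0])
  ultimately show False using x y by auto
qed

text \<open>By \<open>gap_own_crossing\<close> a removed segment could contain this point only as
  its centre. It would then be the under point of the same crossing.\<close>

lemma over_point_kept:
  assumes q: "q \<in> crossings"
  shows "over_point q \<in> kept"
proof -
  have "over_point q \<notin> shift (under_point q') ` {- gap q'<..<gap q'}" if q': "q' \<in> crossings" for q'
  proof
    assume "over_point q \<in> shift (under_point q') ` {- gap q'<..<gap q'}"
    then have "over_point q \<in> shift (under_point q') ` {- gap q'..gap q'}" by auto
    then have eq: "over_point q = under_point q'"
      using gap_own_crossing[OF q' q] crossing_points_in_fibre[OF q] by blast
    then have "q = q'"
      using crossing_points_in_fibre[OF q] crossing_points_in_fibre[OF q'] by (auto simp: fibre_def)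
    then show False using eq over_point_neq_under_point[OF q] by simp
  qed
  then show ?thesis
    using crossing_points_in_fibre[OF q] by (auto simp: kept_def fibre_def)
qed

lemma gap_end_kept:
  assumes q: "q \<in> crossings" and s: "s = gap q \<or> s = - gap q"
  shows "shift (under_point q) s \<in> kept"
proof -
  have u: "under_point q \<in> points"
    using crossing_points_in_fibre[OF q] by (auto simp: fibre_def)
  have "shift (under_point q) s \<notin> shift (under_point q') ` {- gap q'<..<gap q'}" if q': "q' \<in> crossings" for q'
  proof (cases "q' = q")
    case True
    \<comment> \<open>As \<open>gap q < pi\<close>, the closed segment is shorter than a full turn
      and its parametrization is injective, so an end is not an interior point. For other crossings
      the closed segments are disjoint.\<close>
    have "shift (under_point q) s \<noteq> shift (under_point q) t" if t: "t \<in> {- gap q<..<gap q}" for t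
    proof
      assume "shift (under_point q) s = shift (under_point q) t"
      then have "cis s = cis t" using u by (auto simp: shift_def points_def)
      then have "s = t" using s t gap_bounds[OF q] by (intro cis_eq_imp_eq) auto
      then show False using s t by auto
    qed
    then show ?thesis unfolding True by blast
  next
    case False
    have "s \<in> {- gap q..gap q}" using s gap_bounds[OF q] by auto
    then show ?thesis using gaps_disjoint[OF q q'] False by fastforce
  qed
  then show ?thesis
    using shift_in_points[OF u] by (auto simp: kept_def)
qed

definition component_image :: "'m \<Rightarrow> complex set" where
  "component_image i = plane ` {x \<in> kept. fst x = i}"

lemma component_image_closed: "closed (component_image i)"
proof -
  \<comment> \<open>Only crossings whose underpassing strand lies on the component \<open>i\<close>
    remove anything from it.\<close>
  define C where "C = {q \<in> crossings. fst (under_point q) = i}"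
  define Z where "Z = sphere 0 1 - (\<Union>q\<in>C. (\<lambda>s. snd (under_point q) * cis s) ` {- gap q<..<gap q})"
  \<comment> \<open>The leading sphere keeps the set bounded when \<open>C\<close> is empty and the
    intersection is the whole plane.\<close>
  have Z: "Z = sphere 0 1 \<inter> (\<Inter>q\<in>C. sphere 0 1 - (\<lambda>s. snd (under_point q) * cis s) ` {- gap q<..<gap q})"
    by (auto simp: Z_def)
  have "compact Z"
    unfolding Z
  proof (intro compact_Int_closed closed_INT ballI)
    fix q assume "q \<in> C"
    then have q: "q \<in> crossings" by (simp add: C_def)
    have "snd (under_point q) \<in> sphere 0 1"
      using crossing_points_in_fibre[OF q] by (auto simp: fibre_def points_def)
    then show "closed (sphere 0 1 - (\<lambda>s. snd (under_point q) * cis s) ` {- gap q<..<gap q})"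
      using gap_bounds[OF q] by (intro sphere_minus_open_arc_closed) auto
  qed auto
  moreover have "continuous_on Z (\<lambda>z. plane (i, z))"
    using plane_continuous by (rule continuous_on_subset) (auto simp: Z_def)
  ultimately have "compact ((\<lambda>z. plane (i, z)) ` Z)" by (rule compact_continuous_image[rotated])
  moreover have "{x \<in> kept. fst x = i} = Pair i ` Z"
    by (auto simp: kept_def points_def Z_def C_def shift_def image_iff)
  ultimately show ?thesis by (simp add: component_image_def image_image compact_imp_closed)
qed

lemma component_image_disjoint: "i \<noteq> j \<Longrightarrow> component_image i \<inter> component_image j = {}"
  using kept_inj by (auto simp: component_image_def)

lemma diagram_eq_component_images: "diagram = (\<Union>i. component_image i)"
  by (auto simp: diagram_def component_image_def)

lemma arc_index_eq:
  assumes "x \<in> kept"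
  shows "arc_index (connected_component_set diagram (plane x)) = fst x"
proof -
  let ?a = "connected_component_set diagram (plane x)"
  have x: "plane x \<in> ?a" using assms by (auto simp: diagram_def connected_component_refl)
  have xp: "plane x \<in> component_image (fst x)" using assms by (auto simp: component_image_def)
  have "?a \<subseteq> component_image (fst x)"
  proof (rule connected_subset_of_disjoint_closed_union[where P = component_image, OF _ _ component_image_closed component_image_disjoint x xp])
    show "?a \<subseteq> (\<Union>i. component_image i)"
      using connected_component_subset diagram_eq_component_images by auto
  qed auto
  \<comment> \<open>The arc contains \<open>plane x\<close>, which lies in only one component image,
    so the described index is unique.\<close>
  moreover have "i = fst x" if "?a \<subseteq> component_image i" for i
    using that x xp component_image_disjoint by blast
  ultimately show ?thesis
    unfolding arc_index_def component_image_def[symmetric] by (rule the_equality)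
qed

lemma arc_of_kept: "x \<in> kept \<Longrightarrow> connected_component_set diagram (plane x) \<in> arcs"
  by (auto simp: arcs_def components_def diagram_def)

text \<open>Left and right only permute the two ends of the removed segment; both ends are kept and
  lie on the component of the under point.\<close>

lemma under_arcs_index:
  assumes q: "q \<in> crossings"
  shows "arc_index (under_arc_right q) = arc_index (under_arc_left q)"
  using gap_end_kept[OF q]
  by (simp add: under_arc_right_def under_arc_left_def under_arc_before_def under_arc_after_def arc_index_eq)

lemma crossing_arcs:
  assumes q: "q \<in> crossings"
  shows "over_arc q \<in> arcs" "under_arc_right q \<in> arcs" "under_arc_left q \<in> arcs"
proof -
  \<comment> \<open>\<open>over_arc\<close> starts from \<open>q\<close> itself, which belongs to
    the diagram as the image of the kept over point.\<close>
  have "plane (over_point q) = q" using crossing_points_in_fibre[OF q] by (simp add: fibre_def)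
  then show "over_arc q \<in> arcs"
    using arc_of_kept[OF over_point_kept[OF q]] by (simp add: over_arc_def)
  show "under_arc_right q \<in> arcs" "under_arc_left q \<in> arcs"
    using gap_end_kept[OF q]
    by (simp_all add: under_arc_right_def under_arc_left_def under_arc_before_def
        under_arc_after_def arc_of_kept)
qed

lemma exists_arc:
  obtains a where "a \<in> arcs" "arc_index a = i"
proof -
  have "\<exists>x\<in>kept. fst x = i"
  proof (cases "\<exists>q\<in>crossings. fst (under_point q) = i")
    case True
    then obtain q where "q \<in> crossings" "fst (under_point q) = i" by auto
    then show ?thesis using gap_end_kept[of q "gap q"] by (intro bexI) auto
  next
    case False
    then have "(i, 1) \<in> kept" by (auto simp: kept_def points_def shift_def)
    then show ?thesis by force
  qed
  then show thesis using that arc_of_kept arc_index_eq by metis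
qed

end

section \<open>The Alexander module and its quandle\<close>

lemma ring_of_type_algebra_simps:
  shows ring_of_type_algebra_carrier: "carrier (ring_of_type_algebra :: 'a::comm_ring_1 ring) = UNIV"
    and ring_of_type_algebra_mult: "x \<otimes>\<^bsub>ring_of_type_algebra\<^esub> y = x * (y :: 'a)"
    and ring_of_type_algebra_add: "x \<oplus>\<^bsub>ring_of_type_algebra\<^esub> y = x + (y :: 'a)"
    and ring_of_type_algebra_one: "\<one>\<^bsub>ring_of_type_algebra\<^esub> = (1 :: 'a)"
    and ring_of_type_algebra_zero: "\<zero>\<^bsub>ring_of_type_algebra\<^esub> = (0 :: 'a)"
    and ring_of_type_algebra_minus: "x \<ominus>\<^bsub>ring_of_type_algebra\<^esub> y = x - (y :: 'a)"
proof -
  interpret cring "ring_of_type_algebra :: 'a ring" by (rule cring_from_type_algebra)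
  show carrier: "carrier (ring_of_type_algebra :: 'a::comm_ring_1 ring) = UNIV"
    and "x \<otimes>\<^bsub>ring_of_type_algebra\<^esub> y = x * (y :: 'a)"
    and add: "x \<oplus>\<^bsub>ring_of_type_algebra\<^esub> y = x + (y :: 'a)"
    and "\<one>\<^bsub>ring_of_type_algebra\<^esub> = (1 :: 'a)"
    and zero: "\<zero>\<^bsub>ring_of_type_algebra\<^esub> = (0 :: 'a)"
    for x y
    by (simp_all add: ring_of_type_algebra_def)
  have "\<ominus>\<^bsub>ring_of_type_algebra\<^esub> y = - y" for y :: 'a
    by (rule minus_equality) (simp_all add: carrier add zero)
  then show "x \<ominus>\<^bsub>ring_of_type_algebra\<^esub> y = x - y"
    by (simp add: a_minus_def add)
qed

lemma aug_ideal_ideal: "ideal aug_ideal laurent_ring"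
  unfolding aug_ideal_def
  by (intro ring.genideal_ideal ring_from_type_algebra) (simp add: ring_of_type_algebra_simps)

lemma tvar_minus_one_in_aug_ideal: "tvar i \<ominus>\<^bsub>laurent_ring\<^esub> \<one>\<^bsub>laurent_ring\<^esub> \<in> aug_ideal"
  using ring.genideal_self[OF ring_from_type_algebra]
  unfolding aug_ideal_def by (force simp: ring_of_type_algebra_simps)

section \<open>Existence and uniqueness of the map to the augmentation ideal\<close>

context link_diagram
begin

abbreviation "aug_module \<equiv> ideal_module laurent_ring (aug_ideal :: 'm laurent set)"

lemma arc_module_module: "module laurent_ring arc_module"
  by (intro free_module_module cring_from_type_algebra)

lemma aug_module_module: "module laurent_ring aug_module"
  by (intro ideal_module_module cring_from_type_algebra aug_ideal_ideal)

lemma arc_basis_closed: "a \<in> arcs \<Longrightarrow> basis_vec laurent_ring a \<in> carrier arc_module"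
  by (intro basis_vec_closed cring_from_type_algebra)

lemma crossing_relation_closed:
  assumes "q \<in> crossings"
  shows "crossing_relation q \<in> carrier arc_module"
proof -
  interpret module laurent_ring arc_module by (rule arc_module_module)
  show ?thesis
    unfolding crossing_relation_def Let_def
    using crossing_arcs[OF assms]
    by (intro M.minus_closed M.a_closed smult_closed arc_basis_closed)
      (auto simp: ring_of_type_algebra_carrier)
qed

lemma rho_linear: "rho \<in> linear_maps laurent_ring crossing_module arc_module"
  unfolding rho_def[abs_def]
  using crossing_relation_closed
  by (intro linear_combination_linear arc_module_module finite_crossings) auto

lemma rho_image_submodule: "submodule (rho ` carrier crossing_module) laurent_ring arc_module"
  using free_module_module[OF cring_from_type_algebra] arc_module_module rho_linear
  by (rule linear_maps_image_submodule)

lemma alexander_module_module: "module laurent_ring alexander_module"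
  unfolding alexander_module_def
  using arc_module_module rho_image_submodule by (rule quotient_module_module)

lemma gamma_linear: "gamma \<in> linear_maps laurent_ring arc_module alexander_module"
  unfolding alexander_module_def gamma_def[abs_def]
  using arc_module_module rho_image_submodule by (rule coset_linear)

lemma alexander_module_carrier: "carrier alexander_module = gamma ` carrier arc_module"
  unfolding alexander_module_def gamma_def[abs_def]
  using arc_module_module rho_image_submodule by (rule quotient_module_carrier)

text \<open>
  The value is \<open>t\<^bsub>\<kappa>(a\<^sub>2)\<^esub> - t\<^bsub>\<kappa>(a\<^sub>3)\<^esub>\<close>, which vanishes because both underpassing arcs lie on the same
  component.
\<close>

lemma linear_map_kills_crossing_relation:
  assumes f: "f \<in> linear_maps laurent_ring arc_module aug_module"
    and arc: "\<And>a. a \<in> arcs \<Longrightarrow>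
      f (basis_vec laurent_ring a) = tvar (arc_index a) \<ominus>\<^bsub>laurent_ring\<^esub> \<one>\<^bsub>laurent_ring\<^esub>"
    and q: "q \<in> crossings"
  shows "f (crossing_relation q) = \<zero>\<^bsub>aug_module\<^esub>"
proof -
  interpret module laurent_ring arc_module by (rule arc_module_module)
  interpret P: module laurent_ring aug_module by (rule aug_module_module)
  note arcs = crossing_arcs[OF q]
  let ?e = "basis_vec laurent_ring :: _ \<Rightarrow> _ \<Rightarrow> 'm laurent"
  let ?s = "(\<one>\<^bsub>laurent_ring\<^esub> \<ominus>\<^bsub>laurent_ring\<^esub> tvar (arc_index (under_arc_right q)))
      \<odot>\<^bsub>arc_module\<^esub> ?e (over_arc q)"
  let ?t = "tvar (arc_index (over_arc q)) \<odot>\<^bsub>arc_module\<^esub> ?e (under_arc_right q)"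
  have e: "?e (over_arc q) \<in> carrier arc_module" "?e (under_arc_right q) \<in> carrier arc_module"
      "?e (under_arc_left q) \<in> carrier arc_module"
    using arcs by (auto intro: arc_basis_closed)
  have c: "r \<in> carrier laurent_ring" for r :: "'m laurent"
    by (simp add: ring_of_type_algebra_carrier)
  have st: "?s \<in> carrier arc_module" "?t \<in> carrier arc_module"
    using e c by (auto intro!: smult_closed)
  have "f (crossing_relation q) = f (?s \<oplus>\<^bsub>arc_module\<^esub> ?t) \<ominus>\<^bsub>aug_module\<^esub> f (?e (under_arc_left q))"
    unfolding crossing_relation_def Let_def
    using M.a_closed[OF st] e(3)
    by (rule linear_maps_minus[OF arc_module_module aug_module_module f])
  also have "\<dots> = f (?s \<oplus>\<^bsub>arc_module\<^esub> ?t) \<ominus>\<^bsub>laurent_ring\<^esub> f (?e (under_arc_left q))"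
    using linear_maps_closed[OF f] M.a_closed[OF st] e(3)
    by (intro ideal_module_minus cring_from_type_algebra aug_ideal_ideal) (auto simp: ideal_module_simps)
  also have "f (?s \<oplus>\<^bsub>arc_module\<^esub> ?t) = f ?s \<oplus>\<^bsub>laurent_ring\<^esub> f ?t"
    using linear_maps_add[OF f st] by (simp only: ideal_module_simps)
  also have "f ?s = (\<one>\<^bsub>laurent_ring\<^esub> \<ominus>\<^bsub>laurent_ring\<^esub> tvar (arc_index (under_arc_right q)))
      \<otimes>\<^bsub>laurent_ring\<^esub> f (?e (over_arc q))"
    using linear_maps_smult[OF f c e(1)] by (simp only: ideal_module_simps)
  also have "f ?t = tvar (arc_index (over_arc q)) \<otimes>\<^bsub>laurent_ring\<^esub> f (?e (under_arc_right q))"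
    using linear_maps_smult[OF f c e(2)] by (simp only: ideal_module_simps)
  finally show ?thesis
    using arcs under_arcs_index[OF q]
    by (simp add: arc ideal_module_simps ring_of_type_algebra_simps algebra_simps)
qed

text \<open>The values on arcs extend to the free module, and the extension descends to the cokernel
  because it kills the crossing relations. This licenses the definite description
  \<open>phi\<close>.\<close>

lemma phi_unique_exists:
  "\<exists>!\<phi>. \<phi> \<in> linear_maps laurent_ring alexander_module aug_module \<and>
     \<phi> ` carrier alexander_module = aug_ideal \<and>
     \<phi> \<in> extensional (carrier alexander_module) \<and>
     (\<forall>a\<in>arcs. \<phi> (gamma (basis_vec laurent_ring a)) =
        tvar (arc_index a) \<ominus>\<^bsub>laurent_ring\<^esub> \<one>\<^bsub>laurent_ring\<^esub>)"
proof (rule ex_ex1I)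
  interpret P: module laurent_ring aug_module by (rule aug_module_module)
  let ?v = "\<lambda>a. tvar (arc_index a) \<ominus>\<^bsub>laurent_ring\<^esub> \<one>\<^bsub>laurent_ring\<^esub>"
  have v: "?v \<in> arcs \<rightarrow> carrier aug_module"
    by (simp add: ideal_module_simps tvar_minus_one_in_aug_ideal)
  obtain f where f: "f \<in> linear_maps laurent_ring arc_module aug_module"
    and f_arc: "\<And>a. a \<in> arcs \<Longrightarrow> f (basis_vec laurent_ring a) = ?v a"
    using free_module_extension[OF aug_module_module v] by blast
  have "f n = \<zero>\<^bsub>aug_module\<^esub>" if n_in: "n \<in> rho ` carrier crossing_module" for n
  proof -
    interpret F: module laurent_ring arc_module by (rule arc_module_module)
    obtain h where n: "n = rho h" using n_in by auto
    have c: "r \<in> carrier laurent_ring" for r :: "'m laurent"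
      by (simp add: ring_of_type_algebra_carrier)
    \<comment> \<open>An element of the image of \<open>rho\<close> is a combination of crossing
      relations, so each summand is sent to zero.\<close>
    have "f n = (\<Oplus>\<^bsub>aug_module\<^esub>q\<in>crossings. f (h q \<odot>\<^bsub>arc_module\<^esub> crossing_relation q))"
      unfolding n rho_def
      by (rule linear_maps_finsum[OF arc_module_module aug_module_module f finite_crossings])
        (use c crossing_relation_closed in auto)
    also have "\<dots> = (\<Oplus>\<^bsub>aug_module\<^esub>q\<in>crossings. \<zero>\<^bsub>aug_module\<^esub>)"
      using linear_maps_smult[OF f c crossing_relation_closed]
        linear_map_kills_crossing_relation[OF f f_arc] P.smult_r_null[OF c]
      by (intro P.M.finsum_cong') auto
    finally show ?thesis by simp
  qed
  then obtain g where g: "g \<in> linear_maps laurent_ring alexander_module aug_module"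
      "g \<in> extensional (carrier alexander_module)"
    and g_gamma: "\<And>x. x \<in> carrier arc_module \<Longrightarrow> g (gamma x) = f x"
    using quotient_module_extension[OF arc_module_module rho_image_submodule aug_module_module f]
    unfolding alexander_module_def gamma_def by blast
  have g_arc: "g (gamma (basis_vec laurent_ring a)) = ?v a" if "a \<in> arcs" for a
    using that by (simp add: g_gamma arc_basis_closed f_arc)
  let ?H = "g ` carrier alexander_module"
  have "?H \<subseteq> aug_ideal"
    using linear_maps_closed[OF g(1)] by (auto simp: ideal_module_simps)
  \<comment> \<open>The image is an ideal containing every generator, each variable being the one of
    some arc by \<open>exists_arc\<close>; minimality of the generated ideal applies.\<close>
  moreover have "aug_ideal \<subseteq> ?H"
    unfolding aug_ideal_def
  proof (rule ring.genideal_minimal[OF ring_from_type_algebra])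
    show "ideal ?H laurent_ring"
      using linear_maps_image_submodule[OF alexander_module_module aug_module_module g(1)]
      by (intro submodule_ideal_module_imp_ideal[OF _ aug_ideal_ideal] cring_from_type_algebra)
    show "range (\<lambda>i. tvar i \<ominus>\<^bsub>laurent_ring\<^esub> \<one>\<^bsub>laurent_ring\<^esub>) \<subseteq> ?H"
    proof clarify
      fix i :: 'm
      obtain a where a: "a \<in> arcs" "arc_index a = i" by (rule exists_arc)
      then have "gamma (basis_vec laurent_ring a) \<in> carrier alexander_module"
        by (simp add: alexander_module_carrier arc_basis_closed)
      then show "tvar i \<ominus>\<^bsub>laurent_ring\<^esub> \<one>\<^bsub>laurent_ring\<^esub> \<in> ?H"
        using g_arc[OF a(1)] a(2) by (metis image_eqI)
    qed
  qed
  ultimately show "\<exists>\<phi>. \<phi> \<in> linear_maps laurent_ring alexander_module aug_module \<and>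
     \<phi> ` carrier alexander_module = aug_ideal \<and>
     \<phi> \<in> extensional (carrier alexander_module) \<and>
     (\<forall>a\<in>arcs. \<phi> (gamma (basis_vec laurent_ring a)) = ?v a)"
    using g g_arc by blast
next
  fix \<phi> \<psi> :: "(complex set \<Rightarrow> 'm laurent) set \<Rightarrow> 'm laurent"
  assume \<phi>: "\<phi> \<in> linear_maps laurent_ring alexander_module aug_module \<and>
      \<phi> ` carrier alexander_module = aug_ideal \<and>
      \<phi> \<in> extensional (carrier alexander_module) \<and>
      (\<forall>a\<in>arcs. \<phi> (gamma (basis_vec laurent_ring a)) =
        tvar (arc_index a) \<ominus>\<^bsub>laurent_ring\<^esub> \<one>\<^bsub>laurent_ring\<^esub>)"
    and \<psi>: "\<psi> \<in> linear_maps laurent_ring alexander_module aug_module \<and>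
      \<psi> ` carrier alexander_module = aug_ideal \<and>
      \<psi> \<in> extensional (carrier alexander_module) \<and>
      (\<forall>a\<in>arcs. \<psi> (gamma (basis_vec laurent_ring a)) =
        tvar (arc_index a) \<ominus>\<^bsub>laurent_ring\<^esub> \<one>\<^bsub>laurent_ring\<^esub>)"
  \<comment> \<open>Composed with \<open>gamma\<close>, both maps are linear on the free module and
    agree on its basis. Since \<open>gamma\<close> reaches the whole carrier, extensionality then
    yields equality as functions.\<close>
  have "\<phi> (gamma x) = \<psi> (gamma x)" if "x \<in> carrier arc_module" for x
    using linear_maps_comp[OF gamma_linear conjunct1[OF \<phi>]]
      linear_maps_comp[OF gamma_linear conjunct1[OF \<psi>]] _ that
    by (rule free_module_maps_eqI[OF cring_from_type_algebra aug_module_module]) (use \<phi> \<psi> in simp)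
  moreover have "\<phi> \<in> extensional (carrier alexander_module)"
      "\<psi> \<in> extensional (carrier alexander_module)"
    using \<phi> \<psi> by blast+
  ultimately show "\<phi> = \<psi>"
    by (elim extensionalityI) (auto simp: alexander_module_carrier)
qed

lemma phi_linear: "phi \<in> linear_maps laurent_ring alexander_module aug_module"
  using theI'[OF phi_unique_exists] by (simp add: phi_def)

lemma alexander_quandle:
  "quandle {x \<in> carrier alexander_module. phi x \<oplus>\<^bsub>laurent_ring\<^esub> \<one>\<^bsub>laurent_ring\<^esub> \<in> Units laurent_ring}
     (\<lambda>x y. ((phi y \<oplus>\<^bsub>laurent_ring\<^esub> \<one>\<^bsub>laurent_ring\<^esub>) \<odot>\<^bsub>alexander_module\<^esub> x)
        \<ominus>\<^bsub>alexander_module\<^esub> (phi x \<odot>\<^bsub>alexander_module\<^esub> y))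
     (\<lambda>x y. inv\<^bsub>laurent_ring\<^esub> (phi y \<oplus>\<^bsub>laurent_ring\<^esub> \<one>\<^bsub>laurent_ring\<^esub>) \<odot>\<^bsub>alexander_module\<^esub>
        (x \<oplus>\<^bsub>alexander_module\<^esub> (phi x \<odot>\<^bsub>alexander_module\<^esub> y)))"
  using alexander_module_module aug_ideal_ideal phi_linear by (rule quandle_of_linear_map)

end

theorem proposition8:
  fixes K :: "'m::finite \<Rightarrow> complex \<Rightarrow> real ^ 4"
    and rot :: "real ^ 4 ^ 4"
    and gap :: "complex \<Rightarrow> real"
  assumes "link K"
    and "link_diagram K rot gap"
  shows
    "let R = (laurent_ring :: 'm laurent ring);
         M = link_diagram.alexander_module K rot gap;
         \<phi> = link_diagram.phi K rot gap;
         U = {x \<in> carrier M. \<phi> x \<oplus>\<^bsub>R\<^esub> \<one>\<^bsub>R\<^esub> \<in> Units R}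
     in quandle U
          (\<lambda>x y. ((\<phi> y \<oplus>\<^bsub>R\<^esub> \<one>\<^bsub>R\<^esub>) \<odot>\<^bsub>M\<^esub> x) \<ominus>\<^bsub>M\<^esub> (\<phi> x \<odot>\<^bsub>M\<^esub> y))
          (\<lambda>x y. inv\<^bsub>R\<^esub> (\<phi> y \<oplus>\<^bsub>R\<^esub> \<one>\<^bsub>R\<^esub>) \<odot>\<^bsub>M\<^esub> (x \<oplus>\<^bsub>M\<^esub> (\<phi> x \<odot>\<^bsub>M\<^esub> y)))"
  unfolding Let_def using assms(2) by (rule link_diagram.alexander_quandle)

end
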